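(* If $G$ is a connected graph of order $n$, then $$L_2(G)\leq n+1-\Delta(G)-\left\lfloor \frac{\mathrm{diam}(G)-4}{3} \right\rfloor.$$
   Context: All graphs are finite, undirected, simple and nontrivial (at least two vertices). $\Delta(G)$ is the maximum degree, $\mathrm{diam}(G)$ the diameter, and $N[v]=\{v\}\cup N(v)$ the closed neighbourhood of $v$. A set $B\subseteq V(G)$ is a $2$-limited packing if $|N[v]\cap B|\le 2$ for every vertex $v$ of $G$; $L_2(G)$ is the maximum cardinality of a $2$-limited packing in $G$. The floor is that of a possibly negative rational number. *)

theory Defs
  imports "Graph_Theory.Digraph_Component" "Graph_Theory.Shortest_Path"
begin

text \<open>
  Finite simple undirected graphs are given by the locale \<^locale>\<open>graph\<close>: finite symmetric
  digraphs without loops and without parallel arcs, so that an edge is a pair of opposite arcs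
  and the degree of a vertex is its \<^const>\<open>out_degree\<close>.
\<close>

definition max_degree :: "('a,'b) pre_digraph \<Rightarrow> nat" where
  "max_degree G = Max (out_degree G ` verts G)"

definition graph_dist :: "('a,'b) pre_digraph \<Rightarrow> 'a \<Rightarrow> 'a \<Rightarrow> nat" where
  "graph_dist G u v = (LEAST k. \<exists>p. pre_digraph.awalk G u p v \<and> length p = k)"

text \<open>
  Only meaningful for connected graphs: for vertices that no walk joins, the value of
  \<^const>\<open>graph_dist\<close> is unspecified rather than infinite.
\<close>
definition graph_diam :: "('a,'b) pre_digraph \<Rightarrow> nat" where
  "graph_diam G = Max {graph_dist G u v | u v. u \<in> verts G \<and> v \<in> verts G}"

definition closed_nbhd :: "('a,'b) pre_digraph \<Rightarrow> 'a \<Rightarrow> 'a set" where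
  "closed_nbhd G v = insert v {u. v \<rightarrow>\<^bsub>G\<^esub> u}"

definition limited_packing :: "nat \<Rightarrow> ('a,'b) pre_digraph \<Rightarrow> 'a set \<Rightarrow> bool" where
  "limited_packing k G B \<longleftrightarrow>
     B \<subseteq> verts G \<and> (\<forall>v \<in> verts G. card (closed_nbhd G v \<inter> B) \<le> k)"

definition limited_packing_number :: "nat \<Rightarrow> ('a,'b) pre_digraph \<Rightarrow> nat" where
  "limited_packing_number k G = Max {card B | B. limited_packing k G B}"

text \<open>On joined vertices, \<^const>\<open>graph_dist\<close> is the library's shortest-path cost for unit weights.\<close>
lemma (in fin_digraph) graph_dist_eq_mu:
  assumes "u \<rightarrow>\<^sup>*\<^bsub>G\<^esub> v"
  shows "ereal (real (graph_dist G u v)) = \<mu> (\<lambda>_. 1) u v"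
proof -
  have cost: "awalk_cost (\<lambda>_. 1) p = real (length p)" for p :: "'b list"
    by (induction p) auto
  obtain q where "awalk u q v"
    using assms by (auto simp: reachable_awalk)
  then have "\<exists>k p. awalk u p v \<and> length p = k"
    by blast
  from LeastI_ex[OF this] have "\<exists>p. awalk u p v \<and> length p = graph_dist G u v"
    unfolding graph_dist_def .
  then obtain p where p: "awalk u p v" "length p = graph_dist G u v"
    by blast
  have least: "graph_dist G u v \<le> length r" if "awalk u r v" for r
    unfolding graph_dist_def by (rule Least_le) (use that in blast)
  show ?thesis
  proof (rule antisym)
    show "ereal (real (graph_dist G u v)) \<le> \<mu> (\<lambda>_. 1) u v"
      unfolding \<mu>_def by (rule INF_greatest) (simp add: cost least)
    show "\<mu> (\<lambda>_. 1) u v \<le> ereal (real (graph_dist G u v))"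
      using min_cost_le_walk_cost[OF p(1), of "\<lambda>_. 1"] p(2) by (simp add: cost)
  qed
qed

end

theory Submission
  imports Defs
begin

text \<open>
  Let \<open>v\<close> have maximum degree and let \<open>x\<^sub>0, \<dots>, x\<^sub>d\<close> be a shortest path realising the diameter.
  A 2-limited packing \<open>B\<close> meets \<open>N[v]\<close> in at most two vertices, so it misses at least
  \<open>\<Delta> - 1\<close> vertices of \<open>N[v]\<close>. Since \<open>N[v]\<close> lies within the distances \<open>c - 1, c, c + 1\<close> from
  \<open>x\<^sub>0\<close>, where \<open>c\<close> is the distance of \<open>v\<close>, it meets the path in at most the three vertices with
  these indices. Three consecutive vertices of the path lie in the closed neighbourhood of the
  middle one, so \<open>B\<close> misses one of them. Cutting the two remaining pieces of the path
  into triples yields the further missed vertices.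
\<close>

section \<open>Distances and geodesics from a fixed vertex\<close>

context wf_digraph
begin

lemma graph_dist_le_length: "awalk u p v \<Longrightarrow> graph_dist G u v \<le> length p"
  unfolding graph_dist_def by (rule Least_le) blast

lemma shortest_awalkE:
  assumes "u \<rightarrow>\<^sup>* v"
  obtains p where "awalk u p v" "length p = graph_dist G u v"
proof -
  have "\<exists>k p. awalk u p v \<and> length p = k"
    using assms by (auto simp: reachable_awalk)
  from LeastI_ex[OF this] have "\<exists>p. awalk u p v \<and> length p = graph_dist G u v"
    unfolding graph_dist_def .
  with that show ?thesis
    by blast
qed

lemma graph_dist_adj_le:
  assumes "u \<rightarrow>\<^sup>* v" "v \<rightarrow> w"
  shows "graph_dist G u w \<le> Suc (graph_dist G u v)"
proof -
  obtain p where p: "awalk u p v" "length p = graph_dist G u v"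
    using shortest_awalkE[OF assms(1)] .
  obtain e where "e \<in> arcs G" "tail G e = v" "head G e = w"
    using assms(2) by (rule reachableE)
  then have "awalk v [e] w"
    using arc_implies_awalk by blast
  from graph_dist_le_length[OF awalk_appendI[OF p(1) this]] p(2) show ?thesis
    by simp
qed

text \<open>Dropping the last arc of a shortest walk leaves a walk of length \<open>k\<close>, so
  its end is at distance at most \<open>k\<close>; it is not nearer, since one more arc raises the
  distance by at most one.\<close>

lemma graph_dist_predecessorE:
  assumes "u \<rightarrow>\<^sup>* w" "graph_dist G u w = Suc k"
  obtains y where "u \<rightarrow>\<^sup>* y" "y \<rightarrow> w" "graph_dist G u y = k"
proof -
  obtain p where p: "awalk u p w" "length p = Suc k"
    using shortest_awalkE[OF assms(1)] assms(2) by metis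
  then obtain q e where pq: "p = q @ [e]" "length q = k"
    by (metis length_Suc_conv_rev)
  define y where "y = awlast u q"
  have q: "awalk u q y" and e: "awalk y [e] w"
    using p(1) by (auto simp: pq y_def)
  have reach: "u \<rightarrow>\<^sup>* y"
    using q by (auto simp: reachable_awalk)
  have adj: "y \<rightarrow> w"
    using e by (auto simp: awalk_simps arcs_ends_conv)
  have "graph_dist G u y = k"
    using graph_dist_le_length[OF q] graph_dist_adj_le[OF reach adj] pq(2) assms(2) by simp
  with reach adj show ?thesis
    by (rule that)
qed

lemma geodesic_exists:
  assumes "u \<rightarrow>\<^sup>* w" "graph_dist G u w = d"
  \<comment> \<open>Reachability of each \<open>x i\<close> is recorded because
    \<open>graph_dist\<close> is unspecified on vertices that no walk joins.\<close>
  shows "\<exists>x. (\<forall>i\<le>d. u \<rightarrow>\<^sup>* x i \<and> graph_dist G u (x i) = i) \<and> x d = w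
    \<and> (\<forall>i<d. x i \<rightarrow> x (Suc i))"
  using assms
proof (induction d arbitrary: w)
  case 0
  then show ?case
    by (intro exI[of _ "\<lambda>_. w"]) simp
next
  case (Suc d)
  obtain y where y: "u \<rightarrow>\<^sup>* y" "y \<rightarrow> w" "graph_dist G u y = d"
    using graph_dist_predecessorE[OF Suc.prems] .
  from Suc.IH[OF y(1,3)] obtain x where x: "\<forall>i\<le>d. u \<rightarrow>\<^sup>* x i \<and> graph_dist G u (x i) = i"
    "x d = y" "\<forall>i<d. x i \<rightarrow> x (Suc i)"
    by blast
  show ?case
    using x y Suc.prems
    by (intro exI[of _ "x(Suc d := w)"]) (auto simp: le_Suc_eq less_Suc_eq)
qed

end

section \<open>Closed neighbourhoods, and extremal packings and vertex pairs\<close>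

lemma (in nomulti_digraph) card_successors: "card {u. v \<rightarrow> u} = out_degree G v"
proof -
  have "{u. v \<rightarrow> u} = head G ` out_arcs G v"
    by (auto simp: arcs_ends_conv out_arcs_def)
  moreover have "inj_on (head G) (out_arcs G v)"
    by (rule inj_onI) (auto intro: no_multi_arcs simp: arc_to_ends_def)
  ultimately show ?thesis
    by (simp add: card_image out_degree_def)
qed

lemma (in digraph) card_closed_nbhd:
  assumes "v \<in> verts G"
  shows "card (closed_nbhd G v) = Suc (out_degree G v)"
proof -
  have "{u. v \<rightarrow> u} \<subseteq> verts G"
    using adj_in_verts by blast
  then have "finite {u. v \<rightarrow> u}"
    using finite_verts finite_subset by blast
  moreover have "v \<notin> {u. v \<rightarrow> u}"
    using adj_not_same by blast
  ultimately show ?thesis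
    by (simp add: closed_nbhd_def card_successors)
qed

lemma (in wf_digraph) closed_nbhd_subset: "v \<in> verts G \<Longrightarrow> closed_nbhd G v \<subseteq> verts G"
  using adj_in_verts by (auto simp: closed_nbhd_def)

lemma (in fin_digraph) obtain_maximum_limited_packing:
  obtains B where "limited_packing k G B" "card B = limited_packing_number k G"
proof -
  have fin: "finite {card B | B. limited_packing k G B}"
    by (rule finite_subset[of _ "card ` Pow (verts G)"]) (auto simp: limited_packing_def)
  have "limited_packing k G {}"
    by (simp add: limited_packing_def)
  then have "{card B | B. limited_packing k G B} \<noteq> {}"
    by blast
  from Max_in[OF fin this] have "limited_packing_number k G \<in> {card B | B. limited_packing k G B}"
    unfolding limited_packing_number_def .
  then obtain B where "limited_packing k G B" "card B = limited_packing_number k G"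
    by auto
  then show ?thesis
    by (rule that)
qed

text \<open>The bound over all pairs serves to place the vertex of maximum degree no farther from
  \<open>u\<close> than \<open>w\<close> is.\<close>

lemma (in fin_digraph) obtain_diametral_pair:
  assumes "verts G \<noteq> {}"
  obtains u w where "u \<in> verts G" "w \<in> verts G" "graph_dist G u w = graph_diam G"
    "\<And>u' w'. u' \<in> verts G \<Longrightarrow> w' \<in> verts G \<Longrightarrow> graph_dist G u' w' \<le> graph_diam G"
proof -
  let ?D = "{graph_dist G u v | u v. u \<in> verts G \<and> v \<in> verts G}"
  have "?D = (\<lambda>(u, v). graph_dist G u v) ` (verts G \<times> verts G)"
    by auto
  then have fin: "finite ?D"
    by simp
  have ne: "?D \<noteq> {}"
    using assms by blast
  have "graph_diam G \<in> ?D"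
    unfolding graph_diam_def by (rule Max_in[OF fin ne])
  then obtain u w where "u \<in> verts G" "w \<in> verts G" "graph_dist G u w = graph_diam G"
    by auto
  moreover have "graph_dist G u' w' \<le> graph_diam G" if "u' \<in> verts G" "w' \<in> verts G" for u' w'
    unfolding graph_diam_def using that by (intro Max_ge[OF fin]) blast
  ultimately show ?thesis
    by (rule that)
qed

section \<open>Counting integers that meet every block of three\<close>

lemma card_ge_of_triples:
  fixes P :: "nat set"
  assumes "finite P"
    and "\<And>j. s \<le> j \<Longrightarrow> j + 2 < s + 3 * m \<Longrightarrow> {j, j + 1, j + 2} \<inter> P \<noteq> {}"
  shows "m \<le> card (P \<inter> {s..<s + 3 * m})"
  using assms(2)
proof (induction m)
  case (Suc m)
  let ?t = "s + 3 * m"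
  have "{?t, ?t + 1, ?t + 2} \<inter> P \<noteq> {}"
    by (rule Suc.prems) auto
  then obtain i where i: "i \<in> P" "?t \<le> i" "i < s + 3 * Suc m"
    by auto
  \<comment> \<open>The element \<open>i\<close> of the last block lies beyond the earlier ones, so
    it is counted anew.\<close>
  have "Suc m \<le> card (insert i (P \<inter> {s..<?t}))"
    using Suc i(2) by (simp add: assms(1))
  also have "\<dots> \<le> card (P \<inter> {s..<s + 3 * Suc m})"
    using i by (intro card_mono) (auto simp: assms(1))
  finally show ?case .
qed simp

text \<open>The pieces on both sides of the window \<open>c - 1\<close>, \<open>c\<close>,
  \<open>c + 1\<close> have \<open>c - 1\<close> and \<open>d - c - 1\<close> elements, together at
  least \<open>d - 2\<close>. Cutting each into triples wastes at most two elements per piece,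
  whence 6 = 2 + 2 + 2. Truncated subtraction covers \<open>c = 0\<close> and
  \<open>c = d\<close>.\<close>

lemma card_ge_of_triples_outside_window:
  fixes P :: "nat set"
  assumes "finite P" and "c \<le> d"
    and triples: "\<And>j. j + 2 \<le> d \<Longrightarrow> {j, j + 1, j + 2} \<inter> P \<noteq> {}"
  shows "d \<le> 3 * card (P \<inter> ({..<c - 1} \<union> {c + 2..d})) + 6"
proof -
  define a b where "a = (c - 1) div 3" and "b = (d - c - 1) div 3"
  have a: "3 * a \<le> c - 1" "c - 1 \<le> 3 * a + 2" and b: "3 * b \<le> d - c - 1" "d - c - 1 \<le> 3 * b + 2"
    unfolding a_def b_def by linarith+
  have 1: "a \<le> card (P \<inter> {0..<0 + 3 * a})"
    by (rule card_ge_of_triples[OF assms(1)], rule triples) (use a b assms(2) in linarith)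
  have 2: "b \<le> card (P \<inter> {c + 2..<c + 2 + 3 * b})"
    by (rule card_ge_of_triples[OF assms(1)], rule triples) (use a b assms(2) in linarith)
  have "a + b \<le> card (P \<inter> {0..<0 + 3 * a}) + card (P \<inter> {c + 2..<c + 2 + 3 * b})"
    using 1 2 by linarith
  also have "\<dots> = card (P \<inter> {0..<0 + 3 * a} \<union> P \<inter> {c + 2..<c + 2 + 3 * b})"
    using a b by (intro card_Un_disjoint[symmetric]) (auto simp: assms(1))
  also have "\<dots> \<le> card (P \<inter> ({..<c - 1} \<union> {c + 2..d}))"
    using a b assms(2) by (intro card_mono) (auto simp: assms(1))
  finally show ?thesis
    using a b assms(2) by linarith
qed

section \<open>The bound for a single packing, scaled by three to stay in the naturals\<close>

lemma (in graph) limited_packing_card_le: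
  assumes B: "limited_packing 2 G B"
    and v: "v \<in> verts G"
    and reach: "u \<rightarrow>\<^sup>* v" "u \<rightarrow>\<^sup>* w"
    and c: "graph_dist G u v = c"
    and d: "graph_dist G u w = d" "c \<le> d"
  shows "3 * card B + 3 * out_degree G v + d \<le> 3 * card (verts G) + 9"
proof -
  have symD: "b \<rightarrow> a" if "a \<rightarrow> b" for a b
    using that arcs_ends_symmetric[OF sym_arcs] by blast
  let ?N = "closed_nbhd G v"
  have Bsub: "B \<subseteq> verts G" and Ble: "\<And>a. a \<in> verts G \<Longrightarrow> card (closed_nbhd G a \<inter> B) \<le> 2"
    using B by (auto simp: limited_packing_def)
  have Nsub: "?N \<subseteq> verts G"
    by (rule closed_nbhd_subset[OF v])
  have fin: "finite B" "finite ?N"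
    using Bsub Nsub finite_verts finite_subset by blast+
  obtain x where x: "\<And>i. i \<le> d \<Longrightarrow> u \<rightarrow>\<^sup>* x i" "\<And>i. i \<le> d \<Longrightarrow> graph_dist G u (x i) = i"
    and step: "\<And>i. i < d \<Longrightarrow> x i \<rightarrow> x (Suc i)"
    using geodesic_exists[OF reach(2) d(1)] by blast
  have xv: "x i \<in> verts G" if "i \<le> d" for i
    using x(1)[OF that] reachable_in_verts by blast
  have inj: "inj_on x {..d}"
    by (rule inj_on_inverseI[of _ "graph_dist G u"]) (simp add: x(2))
  \<comment> \<open>\<open>P\<close> holds the path positions missed by the packing,
    \<open>Q\<close> those of them outside the window around \<open>c\<close>.\<close>
  define P where "P = {i. i \<le> d \<and> x i \<notin> B}"
  define Q where "Q = P \<inter> ({..<c - 1} \<union> {c + 2..d})"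
  have triples: "{j, j + 1, j + 2} \<inter> P \<noteq> {}" if "j + 2 \<le> d" for j
  proof
    assume "{j, j + 1, j + 2} \<inter> P = {}"
    then have "x ` {j, j + 1, j + 2} \<subseteq> B"
      using that by (auto simp: P_def)
    moreover have "x ` {j, j + 1, j + 2} \<subseteq> closed_nbhd G (x (j + 1))"
      using symD[OF step[of j]] step[of "j + 1"] that by (auto simp: closed_nbhd_def)
    ultimately have "card (x ` {j, j + 1, j + 2}) \<le> card (closed_nbhd G (x (j + 1)) \<inter> B)"
      by (intro card_mono) (auto simp: fin)
    moreover have "card (x ` {j, j + 1, j + 2}) = card {j, j + 1, j + 2}"
      using that by (intro card_image inj_on_subset[OF inj]) auto
    ultimately show False
      using Ble[OF xv[of "j + 1"]] that by simp
  qed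
  have "finite P"
    by (simp add: P_def)
  then have cardQ: "d \<le> 3 * card Q + 6"
    unfolding Q_def using d(2) triples by (rule card_ge_of_triples_outside_window)
  \<comment> \<open>Arcs run both ways, so the distances of adjacent vertices from \<open>u\<close>
    differ by at most one.\<close>
  have window: "c - 1 \<le> graph_dist G u a \<and> graph_dist G u a \<le> c + 1" if "a \<in> ?N" for a
  proof (cases "a = v")
    case False
    with that have "v \<rightarrow> a"
      by (simp add: closed_nbhd_def)
    moreover have "u \<rightarrow>\<^sup>* a"
      using reach(1) \<open>v \<rightarrow> a\<close> by (rule reachable_adj_trans)
    ultimately show ?thesis
      using graph_dist_adj_le[OF reach(1), of a] graph_dist_adj_le[of u a v] symD[of v a] c
      by simp
  qed (simp add: c)
  have disj: "(B \<union> ?N) \<inter> x ` Q = {}"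
  proof -
    have "x i \<notin> B" "x i \<notin> ?N" if "i \<in> Q" for i
      using that window[of "x i"] x(2)[of i] by (auto simp: Q_def P_def)
    then show ?thesis
      by blast
  qed
  have "card Q = card (x ` Q)"
    by (rule card_image[symmetric], rule inj_on_subset[OF inj]) (auto simp: Q_def P_def)
  then have "card (B \<union> ?N) + card Q = card (B \<union> ?N \<union> x ` Q)"
    using disj fin \<open>finite P\<close> by (simp add: card_Un_disjoint Q_def)
  also have "\<dots> \<le> card (verts G)"
    using Bsub Nsub xv by (intro card_mono) (auto simp: Q_def P_def)
  finally have "card (B \<union> ?N) + card Q \<le> card (verts G)" .
  moreover have "card B + card ?N = card (B \<union> ?N) + card (?N \<inter> B)"
    using card_Un_Int[OF fin] by (simp add: Int_commute)
  \<comment> \<open>As \<open>?N\<close> has \<open>out_degree G v + 1\<close> elements, at most two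
    of them in \<open>B\<close>, the union has at least \<open>card B + out_degree G v - 1\<close>.
    After scaling, this -1 and the 6 of \<open>cardQ\<close> give the constant 9.\<close>
  ultimately show ?thesis
    using cardQ Ble[OF v] card_closed_nbhd[OF v] by linarith
qed

theorem theorem4p8:
  fixes G :: "('a,'b) pre_digraph" and n :: nat
  assumes "graph G"
    and "connected G"
    and "card (verts G) = n"
    and "n \<ge> 2"
  shows "int (limited_packing_number 2 G)
      \<le> int n + 1 - int (max_degree G) - \<lfloor>(of_nat (graph_diam G) - 4 :: rat) / 3\<rfloor>"
proof -
  interpret graph G
    by (rule assms(1))
  have sc: "strongly_connected G"
    using symmetric_connected_imp_strongly_connected[OF sym_arcs assms(2)] .
  then have ne: "verts G \<noteq> {}" and reach: "\<And>a b. a \<in> verts G \<Longrightarrow> b \<in> verts G \<Longrightarrow> a \<rightarrow>\<^sup>*\<^bsub>G\<^esub> b"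
    by (auto simp: strongly_connected_def)
  obtain B where B: "limited_packing 2 G B" "card B = limited_packing_number 2 G"
    using obtain_maximum_limited_packing .
  have "max_degree G \<in> out_degree G ` verts G"
    unfolding max_degree_def using ne by (intro Max_in) auto
  then obtain v where v: "v \<in> verts G" "out_degree G v = max_degree G"
    by auto
  let ?d = "graph_diam G"
  obtain u w where u: "u \<in> verts G" and w: "w \<in> verts G" "graph_dist G u w = ?d"
    and diam: "\<And>a b. a \<in> verts G \<Longrightarrow> b \<in> verts G \<Longrightarrow> graph_dist G a b \<le> ?d"
    using obtain_diametral_pair[OF ne] by blast
  define c where "c = graph_dist G u v"
  have cd: "c \<le> ?d"
    unfolding c_def by (rule diam[OF u v(1)])
  have "3 * card B + 3 * out_degree G v + ?d \<le> 3 * card (verts G) + 9"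
    by (rule limited_packing_card_le[OF B(1) v(1) reach[OF u v(1)] reach[OF u w(1)]
          c_def[symmetric] w(2) cd])
  then have main: "3 * limited_packing_number 2 G + 3 * max_degree G + ?d \<le> 3 * n + 9"
    by (simp only: B(2) v(2) assms(3))
  define k where "k = int n + 1 - int (limited_packing_number 2 G) - int (max_degree G)"
  \<comment> \<open>The floor is at most \<open>k\<close> iff its argument is below
    \<open>k + 1\<close>; \<open>main\<close> says \<open>?d\<close> is at most
    \<open>3 * k + 6\<close>, which leaves room to spare.\<close>
  have "int ?d - 4 < 3 * k + 3"
    using main by (simp add: k_def)
  then have "(of_int (int ?d - 4) :: rat) < of_int (3 * k + 3)"
    by (simp only: of_int_less_iff)
  then have "\<lfloor>(of_nat ?d - 4 :: rat) / 3\<rfloor> \<le> k"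
    by (simp add: floor_le_iff field_simps)
  then show ?thesis
    unfolding k_def by linarith
qed

end
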